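(* Let $\Omega\subset\mathbb{R}^d$ be an open convex set with $0<|\Omega|<\infty$. Then $$\frac{1}{d+1}\le\frac{1}{\rho(\Omega)}\,\frac{1}{|\Omega|}\int_\Omega d_\Omega(x)\,dx\le\frac12 .$$ Moreover, both inequalities are sharp. In particular, for any ball $B$ in $\mathbb{R}^d$, $$\sup\{F_{\infty,1}(\Omega) : \Omega\subset\mathbb{R}^d\text{ open and convex},\ 0<|\Omega|<\infty\}=\frac12,$$ $$\min\{F_{\infty,1}(\Omega) : \Omega\subset\mathbb{R}^d\text{ open and convex},\ 0<|\Omega|<\infty\}=F_{\infty,1}(B)=\frac{1}{d+1}.$$
   Context: $|\Omega|$ is the Lebesgue measure, $d_\Omega(x)=\inf\{|x-y| : y\in\partial\Omega\}$ is the distance function from $\partial\Omega$, $\rho(\Omega)=\|d_\Omega\|_{L^\infty(\Omega)}$ is the inradius, and $$F_{\infty,1}(\Omega)=\frac{1}{\rho(\Omega)}\,\frac{1}{|\Omega|}\int_\Omega d_\Omega(x)\,dx .$$ *)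

theory Defs
  imports "HOL-Analysis.Analysis" "HOL-Probability.Essential_Supremum"
begin

definition bdist :: "(real ^ 'n) set \<Rightarrow> real ^ 'n \<Rightarrow> real"
  where "bdist \<Omega> x = infdist x (frontier \<Omega>)"

text \<open>The inradius is the norm of \<^term>\<open>bdist \<Omega>\<close> in $L^\infty(\Omega)$, i.e. an essential supremum.
  It is finite for the sets in \<open>convex_domains\<close> below; \<^const>\<open>real_of_ereal\<close> would send
  an infinite value to 0.\<close>

definition inradius :: "(real ^ 'n) set \<Rightarrow> real"
  where "inradius \<Omega> = real_of_ereal (esssup (lebesgue_on \<Omega>) (\<lambda>x. ereal \<bar>bdist \<Omega> x\<bar>))"

definition F_infty_1 :: "(real ^ 'n) set \<Rightarrow> real"
  where "F_infty_1 \<Omega> =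
    1 / inradius \<Omega> * (1 / measure lebesgue \<Omega>) * (LINT x:\<Omega>|lebesgue. bdist \<Omega> x)"

definition convex_domains :: "(real ^ 'n) set set"
  where "convex_domains =
    {\<Omega>. open \<Omega> \<and> convex \<Omega> \<and> 0 < emeasure lebesgue \<Omega> \<and> emeasure lebesgue \<Omega> < \<infinity>}"

end

theory Submission
  imports Defs
begin

text \<open>
  Write \<open>d\<close> for the distance to the boundary and \<open>\<rho>\<close> for the inradius. The lower bound follows
  from concavity of \<open>d\<close>: if \<open>z\<close> is a point with \<open>d z = r\<close>, the set \<open>{d \<ge> v}\<close> contains a copy of
  \<open>\<Omega>\<close> scaled by \<open>1 - v / r\<close> about \<open>z\<close>; integrate over \<open>v\<close>. For balls this inclusion is an equality.

  For the upper bound, translate, in a polyhedron, the points closest to a given facet along the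
  normal of that facet: layers \<open>{w \<le> d < w + u}\<close> of fixed thickness lose volume as \<open>w\<close> increases.
  By approximation \<open>|{d \<ge> w}| \<le> |{d < R - w}|\<close> for every convex body and every \<open>R > \<rho>\<close>, hence
  \<open>\<integral> d \<le> \<integral> (R - d)\<close>. Long boxes show that the constant \<open>1 / 2\<close> cannot be improved.
\<close>

section \<open>Integration tools: level sets, a power integral, affine images\<close>

text \<open>For fixed \<open>x\<close>, the value \<open>f x\<close> is the length of the set of
  levels \<open>v\<close> in \<open>(0, R)\<close> with \<open>v \<le> f x\<close>; Tonelli then
  swaps levels and points. Any upper bound \<open>R\<close> of \<open>f\<close> on \<open>S\<close>
  serves as the cutoff.\<close>

lemma layer_cake:
  fixes f :: "'a::euclidean_space \<Rightarrow> real"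
  assumes [measurable]: "f \<in> borel_measurable borel" "S \<in> sets borel"
    and f: "\<And>x. x \<in> S \<Longrightarrow> 0 \<le> f x \<and> f x \<le> R"
  shows "(\<integral>\<^sup>+x\<in>S. ennreal (f x) \<partial>lborel)
    = (\<integral>\<^sup>+v\<in>{0<..<R}. emeasure lborel {x\<in>S. v \<le> f x} \<partial>lborel)"
proof -
  have "(\<integral>\<^sup>+x\<in>S. ennreal (f x) \<partial>lborel)
      = (\<integral>\<^sup>+x. \<integral>\<^sup>+v. indicator {v. x \<in> S \<and> 0 < v \<and> v < R \<and> v \<le> f x} v \<partial>lborel \<partial>lborel)"
  proof (rule nn_integral_cong)
    fix x
    show "ennreal (f x) * indicator S x
      = (\<integral>\<^sup>+v. indicator {v. x \<in> S \<and> 0 < v \<and> v < R \<and> v \<le> f x} v \<partial>lborel)"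
    proof (cases "x \<in> S")
      case True
      \<comment> \<open>If \<open>f x = R\<close>, the cutoff \<open>v < R\<close> removes the end
        point \<open>v = f x\<close>; the length is the same in both cases.\<close>
      have "{v. x \<in> S \<and> 0 < v \<and> v < R \<and> v \<le> f x} = (if f x < R then {0<..f x} else {0<..<f x})"
        using f[OF True] True by auto
      then show ?thesis using True f[OF True] by simp
    qed simp
  qed
  also have "\<dots> = (\<integral>\<^sup>+v. \<integral>\<^sup>+x. indicator {v. x \<in> S \<and> 0 < v \<and> v < R \<and> v \<le> f x} v \<partial>lborel \<partial>lborel)"
    by (rule lborel_pair.Fubini') measurable
  also have "\<dots> = (\<integral>\<^sup>+v\<in>{0<..<R}. emeasure lborel {x\<in>S. v \<le> f x} \<partial>lborel)"
  proof (rule nn_integral_cong)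
    fix v
    have "(\<integral>\<^sup>+x. indicator {v. x \<in> S \<and> 0 < v \<and> v < R \<and> v \<le> f x} v \<partial>lborel)
       = (\<integral>\<^sup>+x. indicator {0<..<R} v * indicator {x\<in>S. v \<le> f x} x \<partial>lborel)"
      by (rule nn_integral_cong) (auto simp: indicator_def)
    also have "\<dots> = indicator {0<..<R} v * emeasure lborel {x\<in>S. v \<le> f x}"
      by (subst nn_integral_cmult_indicator) auto
    finally show "(\<integral>\<^sup>+x. indicator {v. x \<in> S \<and> 0 < v \<and> v < R \<and> v \<le> f x} v \<partial>lborel)
       = emeasure lborel {x\<in>S. v \<le> f x} * indicator {0<..<R} v" by (simp add: mult.commute)
  qed
  finally show ?thesis .
qed

text \<open>Source of both constants: \<open>n\<close> equal to the dimension gives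
  \<open>1 / (d + 1)\<close> in the lower bound and for balls, while \<open>n = 1\<close> gives
  \<open>1 / 2\<close> for long boxes.\<close>

lemma nn_integral_power_one_minus_div:
  assumes r: "0 < r"
  shows "(\<integral>\<^sup>+v\<in>{0<..<r}. ennreal ((1 - v / r) ^ n) \<partial>lborel) = ennreal (r / (real n + 1))"
proof -
  have "(\<integral>\<^sup>+v\<in>{0<..<r}. ennreal ((1 - v / r) ^ n) \<partial>lborel)
      = (\<integral>\<^sup>+v. ennreal ((1 - v / r) ^ n) * indicator {0..r} v \<partial>lborel)"
  proof (rule nn_integral_cong_AE)
    \<comment> \<open>The fundamental theorem below works on a closed interval; the two end points
      are null.\<close>
    have "AE v in lborel. v \<noteq> 0 \<and> v \<noteq> r"
      by (intro AE_conjI AE_lborel_singleton)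
    then show "AE v in lborel. ennreal ((1 - v / r) ^ n) * indicator {0<..<r} v
        = ennreal ((1 - v / r) ^ n) * indicator {0..r} v"
      by eventually_elim (auto simp: indicator_def)
  qed
  also have "\<dots> = ennreal (- r / (real n + 1) * (1 - r / r) ^ Suc n - (- r / (real n + 1) * (1 - 0 / r) ^ Suc n))"
  proof (rule nn_integral_FTC_Icc[where F = "\<lambda>v. - r / (real n + 1) * (1 - v / r) ^ Suc n"])
    fix v assume "v \<in> {0..r}"
    have "((\<lambda>v. - r / (real n + 1) * (1 - v / r) ^ Suc n) has_field_derivative
        - r / (real n + 1) * (real (Suc n) * (1 - v / r) ^ n * (- (1 / r)))) (at v)"
      using r by (auto intro!: derivative_eq_intros simp del: power_Suc)
    also have "- r / (real n + 1) * (real (Suc n) * (1 - v / r) ^ n * (- (1 / r))) = (1 - v / r) ^ n"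
    proof -
      have "- r / (real n + 1) * (real (Suc n) * P * (- (1 / r))) = P" for P
      proof -
        have "real n + 1 \<noteq> 0" by simp
        then show ?thesis using r by (simp add: divide_simps)
      qed
      then show ?thesis .
    qed
    finally show "((\<lambda>v. - r / (real n + 1) * (1 - v / r) ^ Suc n) has_real_derivative (1 - v / r) ^ n) (at v)" .
  qed (use r in \<open>auto intro!: zero_le_power\<close>)
  finally show ?thesis using r by simp
qed

lemma emeasure_lborel_affine:
  fixes S :: "'a::euclidean_space set"
  assumes [measurable]: "S \<in> sets borel" and m: "m \<noteq> 0"
  shows "emeasure lborel ((\<lambda>x. m *\<^sub>R x + d) ` S) = ennreal (\<bar>m\<bar> ^ DIM('a)) * emeasure lborel S"
proof -
  \<comment> \<open>Seen as a preimage under a continuous map, the image is Borel, so the Lebesgue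
    scaling formula carries over to \<open>lborel\<close>.\<close>
  have "(\<lambda>x. m *\<^sub>R x + d) ` S = (\<lambda>x. (1 / m) *\<^sub>R (x - d)) -` S"
  proof (intro set_eqI iffI)
    fix y assume "y \<in> (\<lambda>x. (1 / m) *\<^sub>R (x - d)) -` S"
    then show "y \<in> (\<lambda>x. m *\<^sub>R x + d) ` S"
      using m by (intro image_eqI[of _ _ "(1 / m) *\<^sub>R (y - d)"]) auto
  qed (use m in auto)
  moreover have "(\<lambda>x. (1 / m) *\<^sub>R (x - d)) -` S \<in> sets borel"
    using measurable_sets[of "\<lambda>x. (1 / m) *\<^sub>R (x - d)" borel borel S] by simp
  ultimately have "(\<lambda>x. m *\<^sub>R x + d) ` S \<in> sets borel" by simp
  then show ?thesis
    using emeasure_lebesgue_affine[of m d S] by (simp add: emeasure_completion)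
qed

section \<open>Distance to the frontier and inscribed balls; boundedness\<close>

text \<open>Balls are connected: one that meets both \<open>S\<close> and its complement meets the
  frontier, at a distance smaller than the infimum.\<close>

lemma ball_infdist_frontier_subset:
  fixes S :: "'a::euclidean_space set"
  assumes "x \<in> S"
  shows "ball x (infdist x (frontier S)) \<subseteq> S"
proof (rule ccontr)
  assume "\<not> ball x (infdist x (frontier S)) \<subseteq> S"
  then have "ball x (infdist x (frontier S)) - S \<noteq> {}" by blast
  moreover from this have "infdist x (frontier S) > 0"
    by (metis Diff_eq_empty_iff ball_empty empty_subsetI not_le)
  then have "ball x (infdist x (frontier S)) \<inter> S \<noteq> {}"
    using assms centre_in_ball by blast
  ultimately have "ball x (infdist x (frontier S)) \<inter> frontier S \<noteq> {}"
    using connected_Int_frontier[OF connected_ball] by blast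
  then obtain y where "y \<in> frontier S" "dist x y < infdist x (frontier S)" by auto
  then show False using infdist_le[of y "frontier S" x] by simp
qed

text \<open>An open set is disjoint from its frontier, so no frontier point lies in the ball. The
  frontier must be nonempty because \<open>infdist\<close> to the empty set is 0 by default.\<close>

lemma le_infdist_frontier:
  fixes S :: "'a::euclidean_space set"
  assumes "ball x r \<subseteq> S" "open S" "frontier S \<noteq> {}"
  shows "r \<le> infdist x (frontier S)"
proof -
  have "r \<le> dist x y" if "y \<in> frontier S" for y
    using that assms by (force simp: frontier_def interior_open not_less)
  then show ?thesis
    using assms(3) by (auto simp: infdist_notempty intro!: cINF_greatest)
qed

text \<open>Halfway between a fixed inner point and a remote point of \<open>S\<close> there is room
  for a ball of fixed radius inside \<open>S\<close>. Finite measure leaves too little volume far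
  from the origin for such a ball.\<close>

lemma bounded_convex_finite_measure:
  fixes S :: "'a::euclidean_space set"
  assumes "open S" "convex S" and fin: "emeasure lborel S < \<infinity>"
  shows "bounded S"
proof (cases "S = {}")
  case False
  then obtain x where x: "x \<in> S" by auto
  then obtain r where r: "0 < r" "ball x r \<subseteq> S"
    using \<open>open S\<close> by (auto simp: open_contains_ball)
  have [measurable]: "S \<in> sets borel" using \<open>open S\<close> by simp
  let ?A = "\<lambda>n. S - ball 0 (real n)"
  have "(\<lambda>n. emeasure lborel (?A n)) \<longlonglongrightarrow> emeasure lborel (\<Inter>n. ?A n)"
  proof (rule Lim_emeasure_decseq)
    show "decseq ?A" by (auto simp: decseq_def)
    have "emeasure lborel (?A n) \<le> emeasure lborel S" for n
      by (intro emeasure_mono) auto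
    then show "emeasure lborel (?A n) \<noteq> \<infinity>" for n
      using fin by (metis infinity_ennreal_def less_irrefl order.strict_trans1)
  qed auto
  moreover have "(\<Inter>n. ?A n) = {}"
    using reals_Archimedean2 by fastforce
  ultimately have lim: "(\<lambda>n. emeasure lborel (?A n)) \<longlonglongrightarrow> 0" by (simp only: emeasure_empty)
  have pos: "emeasure lborel (ball (0::'a) (r / 2)) > 0"
    using r by (simp add: emeasure_ball)
  \<comment> \<open>From radius \<open>n\<close> on, the rest of \<open>S\<close> has less volume
    than a ball of radius \<open>r / 2\<close>.\<close>
  obtain n where n: "emeasure lborel (?A n) < emeasure lborel (ball (0::'a) (r / 2))"
    using order_tendstoD(2)[OF lim pos] by (auto simp: eventually_sequentially)
  have "norm y \<le> 2 * (real n + r / 2) + norm x" if y: "y \<in> S" for y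
  proof -
    define m where "m = (1 / 2) *\<^sub>R (x + y)"
    \<comment> \<open>A point \<open>z\<close> within \<open>r / 2\<close> of the midpoint
      \<open>m\<close> is itself the midpoint of \<open>y\<close> and
      \<open>2 *\<^sub>R z - y\<close>, and the latter is within \<open>r\<close> of
      \<open>x\<close>.\<close>
    have "ball m (r / 2) \<subseteq> S"
    proof
      fix z assume z: "z \<in> ball m (r / 2)"
      have "norm (x - (2 *\<^sub>R z - y)) = norm (2 *\<^sub>R (m - z))"
        by (simp add: m_def algebra_simps)
      also have "\<dots> < r"
        using z by (simp add: dist_norm)
      finally have "2 *\<^sub>R z - y \<in> S"
        using r by (auto simp: dist_norm subset_iff)
      from convexD[OF \<open>convex S\<close> this y, of "1/2" "1/2"] show "z \<in> S"
        by (simp add: algebra_simps)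
    qed
    moreover have "\<not> ball m (r / 2) \<subseteq> ?A n"
    proof
      assume "ball m (r / 2) \<subseteq> ?A n"
      then have "emeasure lborel (ball m (r / 2)) \<le> emeasure lborel (?A n)"
        by (intro emeasure_mono) auto
      then show False using n r by (simp add: emeasure_ball)
    qed
    ultimately obtain z where "z \<in> ball m (r / 2)" "z \<in> ball 0 (real n)" by blast
    then have "norm m \<le> real n + r / 2"
      using norm_triangle_ineq[of "m - z" z] by (simp add: dist_norm)
    moreover have "y = 2 *\<^sub>R m - x" by (simp add: m_def)
    then have "norm y \<le> 2 * norm m + norm x"
      using norm_triangle_ineq4[of "2 *\<^sub>R m" x] by simp
    ultimately show ?thesis by argo
  qed
  then show ?thesis by (auto simp: bounded_iff)
qed simp

section \<open>Upper bound: comparing volumes of boundary layers\<close>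

text \<open>The cell where facet \<open>i\<close> is the first nearest one is stable under translation along its outer normal \<open>a i\<close>,
  which moves the upper layer of the cell into the lower one.\<close>

lemma polyhedral_layers_decreasing:
  fixes a :: "nat \<Rightarrow> 'a::euclidean_space" and b :: "nat \<Rightarrow> real" and n :: nat
  defines "t \<equiv> \<lambda>i x. b i - a i \<bullet> x"
  defines "layer \<equiv> \<lambda>\<alpha> \<beta>. {x. (\<forall>i<n. \<alpha> \<le> t i x) \<and> (\<exists>i<n. t i x < \<beta>)}"
  assumes a: "\<And>i. i < n \<Longrightarrow> norm (a i) = 1" and "\<delta> \<le> w"
  shows "emeasure lborel (layer w (w + u)) \<le> emeasure lborel (layer \<delta> (\<delta> + u))"
proof -
  \<comment> \<open>The strict inequality for \<open>j < i\<close> breaks ties in favour of the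
    smallest index, which makes the cells disjoint.\<close>
  define C where "C i = {x. \<forall>j<n. t i x \<le> t j x \<and> (j < i \<longrightarrow> t i x < t j x)}" for i
  have [measurable]: "t i \<in> borel_measurable borel" for i
    unfolding t_def by measurable
  have [measurable]: "layer \<alpha> \<beta> \<in> sets borel" for \<alpha> \<beta>
    unfolding layer_def by measurable
  have [measurable]: "C i \<in> sets borel" for i
    unfolding C_def by measurable
  have disj: "disjoint_family_on (\<lambda>i. layer \<alpha> \<beta> \<inter> C i) {..<n}" for \<alpha> \<beta>
  proof (clarsimp simp: disjoint_family_on_def)
    fix i j assume ij: "i < n" "j < n" "i \<noteq> j"
    have "False" if "x \<in> C i" "x \<in> C j" for x
    proof -
      have i: "t i x \<le> t j x" "j < i \<Longrightarrow> t i x < t j x"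
        using \<open>x \<in> C i\<close> ij(2) unfolding C_def by blast+
      have j: "t j x \<le> t i x" "i < j \<Longrightarrow> t j x < t i x"
        using \<open>x \<in> C j\<close> ij(1) unfolding C_def by blast+
      show False using i j ij(3) by (cases "i < j") auto
    qed
    then show "layer \<alpha> \<beta> \<inter> C i \<inter> (layer \<alpha> \<beta> \<inter> C j) = {}"
      by blast
  qed
  have cover: "layer \<alpha> \<beta> = (\<Union>i<n. layer \<alpha> \<beta> \<inter> C i)" for \<alpha> \<beta>
  proof
    show "layer \<alpha> \<beta> \<subseteq> (\<Union>i<n. layer \<alpha> \<beta> \<inter> C i)"
    proof
      fix x assume x: "x \<in> layer \<alpha> \<beta>"
      define P where "P i \<longleftrightarrow> i < n \<and> (\<forall>j<n. t i x \<le> t j x)" for i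
      from x have "{..<n} \<noteq> {}" by (auto simp: layer_def)
      then obtain i where "is_arg_min (\<lambda>i. t i x) (\<lambda>i. i \<in> {..<n}) i"
        using ex_is_arg_min_if_finite[OF finite_lessThan] by blast
      then have "P i" by (auto simp: is_arg_min_linorder P_def)
      \<comment> \<open>Among the facets of minimal \<open>t\<close>, the one of least index is the
        one whose cell contains \<open>x\<close>.\<close>
      define k where "k = (LEAST i. P i)"
      have k: "P k" unfolding k_def using \<open>P i\<close> by (rule LeastI)
      have "t k x < t j x" if "j < k" for j
      proof (rule ccontr)
        assume "\<not> t k x < t j x"
        then have "P j"
          using k that unfolding P_def by (meson less_trans not_less order_trans)
        then show False using not_less_Least[of j P] that unfolding k_def by simp
      qed
      then have "x \<in> C k" using k by (auto simp: C_def P_def)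
      then show "x \<in> (\<Union>i<n. layer \<alpha> \<beta> \<inter> C i)" using k x by (auto simp: P_def)
    qed
  qed auto
  have le: "emeasure lborel (layer w (w + u) \<inter> C i) \<le> emeasure lborel (layer \<delta> (\<delta> + u) \<inter> C i)"
    if i: "i < n" for i
  proof -
    \<comment> \<open>This shift lowers \<open>t i\<close> by exactly \<open>w - \<delta>\<close>,
      because the normal has unit length.\<close>
    define c where "c = (w - \<delta>) *\<^sub>R a i"
    have ti: "t i (c + x) = t i x - (w - \<delta>)" for x
      using a[OF i] by (simp add: t_def c_def inner_add_right dot_square_norm)
    \<comment> \<open>By Cauchy-Schwarz every other \<open>t j\<close> drops by at most the same
      amount, so facet \<open>i\<close> stays the first nearest one and all \<open>t j\<close> stay
      above \<open>\<delta>\<close>.\<close>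
    have tj: "t j (c + x) \<ge> t j x - (w - \<delta>)" if "j < n" for j x
    proof -
      have "a j \<bullet> a i \<le> 1" using norm_cauchy_schwarz[of "a j" "a i"] a[OF i] a[OF that] by simp
      then have "(w - \<delta>) * (a j \<bullet> a i) \<le> (w - \<delta>) * 1"
        using \<open>\<delta> \<le> w\<close> by (intro mult_left_mono) auto
      then show ?thesis by (simp add: t_def c_def inner_add_right)
    qed
    have "emeasure lborel (layer w (w + u) \<inter> C i)
        \<le> emeasure lborel ((+) c -` (layer \<delta> (\<delta> + u) \<inter> C i))"
    proof (rule emeasure_mono)
      show "layer w (w + u) \<inter> C i \<subseteq> (+) c -` (layer \<delta> (\<delta> + u) \<inter> C i)"
      proof
        fix x assume x: "x \<in> layer w (w + u) \<inter> C i"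
        then obtain k where k: "k < n" "t k x < w + u" and w: "\<forall>j<n. w \<le> t j x"
          unfolding layer_def by blast
        have C: "t i x \<le> t j x" "j < i \<Longrightarrow> t i x < t j x" if "j < n" for j
          using x that unfolding C_def by blast+
        have "t i x < w + u" using C(1)[OF k(1)] k(2) by linarith
        moreover have "\<delta> \<le> t j (c + x)" if "j < n" for j
          using w tj[OF that, of x] that by (auto dest!: spec[of _ j])
        moreover have "t i (c + x) \<le> t j (c + x)" "j < i \<Longrightarrow> t i (c + x) < t j (c + x)" if "j < n" for j
          using C[OF that] tj[OF that, of x] ti[of x] by auto
        then have "c + x \<in> C i" unfolding C_def by blast
        ultimately show "x \<in> (+) c -` (layer \<delta> (\<delta> + u) \<inter> C i)"
          using i ti[of x] by (auto simp: layer_def intro!: exI[of _ i])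
      qed
      show "(+) c -` (layer \<delta> (\<delta> + u) \<inter> C i) \<in> sets lborel"
        using measurable_sets[of "(+) c" borel borel "layer \<delta> (\<delta> + u) \<inter> C i"] by simp
    qed
    also have "\<dots> = emeasure (distr lborel borel ((+) c)) (layer \<delta> (\<delta> + u) \<inter> C i)"
      by (subst emeasure_distr) auto
    finally show ?thesis by (simp add: lborel_distr_plus)
  qed
  have sum: "(\<Sum>i<n. emeasure lborel (layer \<alpha> \<beta> \<inter> C i)) = emeasure lborel (layer \<alpha> \<beta>)" for \<alpha> \<beta>
  proof -
    have sub: "(\<lambda>i. layer \<alpha> \<beta> \<inter> C i) ` {..<n} \<subseteq> sets lborel" by auto
    show ?thesis
      by (simp only: sum_emeasure[OF sub disj finite_lessThan] cover[symmetric])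
  qed
  have "(\<Sum>i<n. emeasure lborel (layer w (w + u) \<inter> C i))
      \<le> (\<Sum>i<n. emeasure lborel (layer \<delta> (\<delta> + u) \<inter> C i))"
    by (intro sum_mono le) simp
  then show ?thesis unfolding sum .
qed

text \<open>Separate \<open>S\<close> from the point \<open>q\<close> and normalise; with a unit
  normal, \<open>a \<bullet> q - a \<bullet> x\<close> is the signed distance from \<open>x\<close>
  to the hyperplane through \<open>q\<close>.\<close>

lemma supporting_unit_normal:
  fixes S :: "'a::euclidean_space set"
  assumes "convex S" "S \<noteq> {}" "q \<notin> S"
  obtains a where "norm a = 1" "\<And>x. x \<in> S \<Longrightarrow> a \<bullet> x \<le> a \<bullet> q"
proof -
  obtain a b where a: "a \<noteq> 0" "\<And>x. x \<in> S \<Longrightarrow> a \<bullet> x \<le> b" "b \<le> a \<bullet> q"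
    using separating_hyperplane_sets[of S "{q}"] assms by auto
  have "(a /\<^sub>R norm a) \<bullet> x \<le> (a /\<^sub>R norm a) \<bullet> q" if "x \<in> S" for x
    using a(2)[OF that] a(3) by (simp add: divide_right_mono flip: divide_inverse_commute)
  then show thesis using a(1) by (intro that[of "a /\<^sub>R norm a"]) auto
qed

lemma frontier_nonempty_of_bounded:
  fixes S :: "'a::euclidean_space set"
  assumes "S \<noteq> {}" "bounded S"
  shows "frontier S \<noteq> {}"
  using assms frontier_eq_empty not_bounded_UNIV by blast

lemma borel_measurable_infdist [measurable]:
  "(\<lambda>x::'a::euclidean_space. infdist x S) \<in> borel_measurable borel"
  by (intro borel_measurable_continuous_onI continuous_intros)

text \<open>The ball around \<open>x\<close> whose radius is its distance to the frontier stays in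
  \<open>S\<close>; were that radius too large, moving from \<open>x\<close> along \<open>a\<close>
  within the ball would leave the half-space.\<close>

lemma infdist_frontier_le_halfspace:
  fixes S :: "'a::euclidean_space set"
  assumes "x \<in> S" "norm a = 1" and a: "\<And>y. y \<in> S \<Longrightarrow> a \<bullet> y \<le> b"
  shows "infdist x (frontier S) \<le> b - a \<bullet> x"
proof (rule ccontr)
  assume "\<not> infdist x (frontier S) \<le> b - a \<bullet> x"
  then obtain s where s: "b - a \<bullet> x < s" "s < infdist x (frontier S)"
    using dense by (auto simp: not_le)
  have "0 \<le> b - a \<bullet> x" using a[OF \<open>x \<in> S\<close>] by simp
  then have "x + s *\<^sub>R a \<in> ball x (infdist x (frontier S))"
    using s \<open>norm a = 1\<close> by (simp add: dist_norm)
  then have "a \<bullet> (x + s *\<^sub>R a) \<le> b"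
    using ball_infdist_frontier_subset[OF \<open>x \<in> S\<close>] a by blast
  then show False using s \<open>norm a = 1\<close> by (simp add: inner_add_right dot_square_norm)
qed

text \<open>A finite \<open>\<epsilon>\<close>-net of the boundary yields a circumscribed polyhedron whose distance function
  exceeds that of \<open>S\<close> by at most \<open>\<epsilon>\<close>.\<close>

lemma emeasure_superlevel_le_sublevel:
  fixes S :: "'a::euclidean_space set"
  defines "d \<equiv> \<lambda>x. infdist x (frontier S)"
  assumes S: "open S" "convex S" "bounded S" "S \<noteq> {}"
    and \<rho>: "\<And>x. x \<in> S \<Longrightarrow> d x \<le> \<rho>"
    and vw: "0 < v" "0 < w" "\<rho> < v + w"
  shows "emeasure lborel {x\<in>S. w \<le> d x} \<le> emeasure lborel {x\<in>S. d x < v}"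
proof -
  have ne: "frontier S \<noteq> {}" using S by (intro frontier_nonempty_of_bounded)
  obtain z where z: "z \<in> S" using S by auto
  then obtain r where r: "0 < r" "ball z r \<subseteq> S"
    using S(1) by (auto simp: open_contains_ball)
  then have rz: "r \<le> d z"
    unfolding d_def using le_infdist_frontier[of z r S] S ne by simp
  \<comment> \<open>The lower layer will start at depth \<open>\<delta>\<close> below the facets,
    which keeps it inside \<open>S\<close>; halving the minimum keeps the inequalities
    strict.\<close>
  define \<delta> where "\<delta> = min (min w v) (v + w - \<rho>) / 2"
  have \<delta>: "0 < \<delta>" "\<delta> \<le> w" "\<rho> < v + w - \<delta>"
    using vw by (auto simp: \<delta>_def min_def field_simps)
  \<comment> \<open>The mesh of the net: small enough against \<open>\<delta>\<close> and the inner
    ball for \<open>inS\<close>, and small enough that an error \<open>\<epsilon>\<close> in the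
    distance is absorbed by the gap in \<open>\<rho> < v + w - \<delta>\<close>.\<close>
  define \<epsilon> where "\<epsilon> = min (min \<delta> r) (v + w - \<delta> - \<rho>) / 2"
  have \<epsilon>: "0 < \<epsilon>" "\<epsilon> \<le> \<delta>" "\<epsilon> \<le> r" "\<rho> + \<epsilon> < v + w - \<delta>"
    using \<delta> r by (auto simp: \<epsilon>_def min_def field_simps)
  have "compact (frontier S)" using S by (simp add: compact_frontier_bounded)
  then obtain P where P: "P \<subseteq> frontier S" "finite P" "frontier S \<subseteq> (\<Union>q\<in>P. ball q \<epsilon>)"
    by (rule compactE_image[of _ "frontier S" "\<lambda>q. ball q \<epsilon>"]) (use \<epsilon>(1) in auto)
  obtain n :: nat and p where p: "P = p ` {i. i < n}"
    using finite_imp_nat_seg_image_inj_on[OF P(2)] by blast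
  have net: "\<exists>i<n. dist (p i) q < \<epsilon>" if "q \<in> frontier S" for q
    using that P(3) unfolding p by force
  have "\<exists>a. norm a = 1 \<and> (\<forall>x\<in>S. a \<bullet> x \<le> a \<bullet> p i)" if "i < n" for i
  proof -
    have "p i \<notin> S" using P(1) that S(1) unfolding p by (auto simp: frontier_def interior_open)
    then show ?thesis using supporting_unit_normal[OF S(2,4)] by metis
  qed
  then obtain a where a: "\<And>i. i < n \<Longrightarrow> norm (a i) = 1"
    and sup: "\<And>i x. i < n \<Longrightarrow> x \<in> S \<Longrightarrow> a i \<bullet> x \<le> a i \<bullet> p i"
    by metis
  define t where "t i x = a i \<bullet> p i - a i \<bullet> x" for i x
  have t_le: "t i x \<le> dist (p i) x" if "i < n" for i x
    using norm_cauchy_schwarz[of "a i" "p i - x"] a[OF that]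
    by (simp add: t_def inner_diff_right dist_norm)
  have d_le: "d x \<le> t i x" if "x \<in> S" "i < n" for i x
    unfolding d_def t_def using that a sup by (intro infdist_frontier_le_halfspace) auto
  \<comment> \<open>A net point close to the frontier point nearest to \<open>x\<close> is within
    \<open>d x + \<epsilon>\<close> of \<open>x\<close>, and \<open>t i\<close> is at most the
    distance to \<open>p i\<close>.\<close>
  have t_near: "\<exists>i<n. t i x < d x + \<epsilon>" if "x \<in> S" for x
  proof -
    obtain y where y: "y \<in> frontier S" "d x = dist x y"
      using infdist_attains_inf[OF frontier_closed ne, of x] unfolding d_def by metis
    obtain i where i: "i < n" "dist (p i) y < \<epsilon>" using net[OF y(1)] by blast
    have "dist (p i) x \<le> dist (p i) y + dist x y" by (metis dist_commute dist_triangle)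
    then show ?thesis using i t_le[OF i(1), of x] y(2) by (intro exI[of _ i]) auto
  qed
  \<comment> \<open>Otherwise the segment from \<open>z\<close> to \<open>x\<close> crosses the
    frontier at some \<open>q\<close> near a net point \<open>p i\<close>. The affine function
    \<open>t i\<close> is at least \<open>\<epsilon>\<close> at both ends, yet less than
    \<open>\<epsilon>\<close> at \<open>q\<close>.\<close>
  have inS: "x \<in> S" if x: "\<And>i. i < n \<Longrightarrow> \<delta> \<le> t i x" for x
  proof (rule ccontr)
    assume "x \<notin> S"
    then have "closed_segment z x \<inter> frontier S \<noteq> {}"
      using z by (intro connected_Int_frontier) auto
    then obtain q l where q: "q \<in> frontier S" and l: "0 \<le> l" "l \<le> 1" "q = (1 - l) *\<^sub>R z + l *\<^sub>R x"
      by (auto simp: closed_segment_def)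
    obtain i where i: "i < n" "dist (p i) q < \<epsilon>" using net[OF q] by blast
    have "t i q = (1 - l) * t i z + l * t i x"
      by (simp add: t_def l(3) inner_add_right algebra_simps)
    moreover have "(1 - l) * \<epsilon> \<le> (1 - l) * t i z"
      using d_le[OF z i(1)] rz \<epsilon> l by (intro mult_left_mono) auto
    moreover have "l * \<epsilon> \<le> l * t i x"
      using x[OF i(1)] \<epsilon> l by (intro mult_left_mono) auto
    ultimately have "\<epsilon> \<le> t i q" by (simp add: algebra_simps)
    then show False using i t_le[OF i(1), of q] by simp
  qed
  have [measurable]: "S \<in> sets borel" using S by simp
  have [measurable]: "d \<in> borel_measurable borel" unfolding d_def by measurable
  define layer where "layer \<alpha> \<beta> = {x. (\<forall>i<n. \<alpha> \<le> t i x) \<and> (\<exists>i<n. t i x < \<beta>)}" for \<alpha> \<beta>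
  have [measurable]: "layer \<alpha> \<beta> \<in> sets borel" for \<alpha> \<beta>
    unfolding layer_def t_def by measurable
  \<comment> \<open>Thickness \<open>v - \<delta>\<close> suffices, since some \<open>t i x\<close>
    is below \<open>d x + \<epsilon>\<close>, hence below \<open>w + (v - \<delta>)\<close>. The
    shifted layer then ends at height \<open>v\<close>.\<close>
  have "emeasure lborel {x\<in>S. w \<le> d x} \<le> emeasure lborel (layer w (w + (v - \<delta>)))"
  proof (rule emeasure_mono)
    show "{x\<in>S. w \<le> d x} \<subseteq> layer w (w + (v - \<delta>))"
    proof clarify
      fix x assume x: "x \<in> S" "w \<le> d x"
      obtain i where "i < n" "t i x < d x + \<epsilon>" using t_near[OF x(1)] by blast
      then show "x \<in> layer w (w + (v - \<delta>))"
        using x d_le[OF x(1)] \<rho>[OF x(1)] \<epsilon>(4) unfolding layer_def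
        by (auto intro!: exI[of _ i] intro: order_trans)
    qed
  qed simp
  also have "\<dots> \<le> emeasure lborel (layer \<delta> (\<delta> + (v - \<delta>)))"
    unfolding layer_def t_def using a \<delta> by (intro polyhedral_layers_decreasing) auto
  also have "\<dots> \<le> emeasure lborel {x\<in>S. d x < v}"
  proof (rule emeasure_mono)
    show "layer \<delta> (\<delta> + (v - \<delta>)) \<subseteq> {x\<in>S. d x < v}"
      using inS d_le unfolding layer_def by (auto intro: le_less_trans)
  qed simp
  finally show ?thesis .
qed

text \<open>Apply the layer-cake formula to both \<open>d\<close> and \<open>R - d\<close>. The two
  levels compared, \<open>v\<close> and \<open>R - v\<close>, add up to \<open>R\<close>, and
  \<open>\<rho> < R\<close> supplies the strict gap required by the level comparison.\<close>

lemma nn_integral_infdist_frontier_upper: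
  fixes S :: "'a::euclidean_space set"
  defines "d \<equiv> \<lambda>x. infdist x (frontier S)"
  assumes S: "open S" "convex S" "bounded S" "S \<noteq> {}"
    and \<rho>: "\<And>x. x \<in> S \<Longrightarrow> d x \<le> \<rho>" "\<rho> < R"
  shows "2 * (\<integral>\<^sup>+x\<in>S. ennreal (d x) \<partial>lborel) \<le> ennreal R * emeasure lborel S"
proof -
  have [measurable]: "S \<in> sets borel" using S by simp
  have [measurable]: "d \<in> borel_measurable borel" unfolding d_def by measurable
  have d0: "0 \<le> d x" for x by (simp add: d_def infdist_nonneg)
  have dR: "d x \<le> R" if "x \<in> S" for x using \<rho>(1)[OF that] \<rho>(2) by simp
  have "(\<integral>\<^sup>+x\<in>S. ennreal (d x) \<partial>lborel) = (\<integral>\<^sup>+v\<in>{0<..<R}. emeasure lborel {x\<in>S. v \<le> d x} \<partial>lborel)"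
    using d0 dR by (intro layer_cake) auto
  also have "\<dots> \<le> (\<integral>\<^sup>+v\<in>{0<..<R}. emeasure lborel {x\<in>S. v \<le> R - d x} \<partial>lborel)"
  proof (rule nn_integral_mono)
    fix v
    have "emeasure lborel {x\<in>S. v \<le> d x} \<le> emeasure lborel {x\<in>S. v \<le> R - d x}" if v: "0 < v" "v < R"
    proof -
      have "emeasure lborel {x\<in>S. v \<le> d x} \<le> emeasure lborel {x\<in>S. d x < R - v}"
        unfolding d_def using S \<rho> v
        by (intro emeasure_superlevel_le_sublevel[where \<rho> = \<rho>]) (auto simp: d_def)
      also have "\<dots> \<le> emeasure lborel {x\<in>S. v \<le> R - d x}"
        by (intro emeasure_mono) auto
      finally show ?thesis .
    qed
    then show "emeasure lborel {x\<in>S. v \<le> d x} * indicator {0<..<R} v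
      \<le> emeasure lborel {x\<in>S. v \<le> R - d x} * indicator {0<..<R} v"
      by (auto simp: indicator_def)
  qed
  also have "\<dots> = (\<integral>\<^sup>+x\<in>S. ennreal (R - d x) \<partial>lborel)"
    using d0 dR by (intro layer_cake[symmetric]) auto
  finally have le: "(\<integral>\<^sup>+x\<in>S. ennreal (d x) \<partial>lborel) \<le> (\<integral>\<^sup>+x\<in>S. ennreal (R - d x) \<partial>lborel)" .
  have "2 * (\<integral>\<^sup>+x\<in>S. ennreal (d x) \<partial>lborel)
      \<le> (\<integral>\<^sup>+x\<in>S. ennreal (d x) \<partial>lborel) + (\<integral>\<^sup>+x\<in>S. ennreal (R - d x) \<partial>lborel)"
    using le by (simp add: mult_2 add_left_mono)
  also have "\<dots> = (\<integral>\<^sup>+x. ennreal (d x) * indicator S x + ennreal (R - d x) * indicator S x \<partial>lborel)"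
    by (intro nn_integral_add[symmetric]) auto
  also have "\<dots> = (\<integral>\<^sup>+x. ennreal R * indicator S x \<partial>lborel)"
  proof (rule nn_integral_cong)
    fix x
    show "ennreal (d x) * indicator S x + ennreal (R - d x) * indicator S x = ennreal R * indicator S x"
      using d0[of x] dR[of x] by (cases "x \<in> S") (auto simp flip: ennreal_plus)
  qed
  also have "\<dots> = ennreal R * emeasure lborel S" by (simp add: nn_integral_cmult_indicator)
  finally show ?thesis .
qed

section \<open>Lower bound: homothetic copies inside superlevel sets\<close>

text \<open>Stated for an arbitrary point \<open>z\<close>, so that the supremum over
  \<open>z\<close> can be taken later without finding a deepest point.\<close>

lemma nn_integral_infdist_frontier_lower:
  fixes S :: "'a::euclidean_space set"
  defines "d \<equiv> \<lambda>x. infdist x (frontier S)"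
  assumes S: "open S" "convex S" "bounded S" and "z \<in> S"
    and R: "\<And>x. x \<in> S \<Longrightarrow> d x \<le> R"
  shows "ennreal (d z / (real DIM('a) + 1)) * emeasure lborel S \<le> (\<integral>\<^sup>+x\<in>S. ennreal (d x) \<partial>lborel)"
proof (cases "d z = 0")
  case False
  define r where "r = d z"
  have r: "0 < r" using False by (simp add: r_def d_def infdist_nonneg order_less_le)
  have ne: "frontier S \<noteq> {}" using assms by (intro frontier_nonempty_of_bounded) auto
  have [measurable]: "S \<in> sets borel" using S by simp
  have [measurable]: "d \<in> borel_measurable borel" unfolding d_def by measurable
  have rS: "ball z r \<subseteq> S"
    unfolding r_def d_def by (rule ball_infdist_frontier_subset[OF \<open>z \<in> S\<close>])
  \<comment> \<open>The superlevel set contains the image of \<open>S\<close> under the homothety of ratio \<open>1 - v / r\<close> centred at \<open>z\<close>.\<close>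
  have level: "ennreal ((1 - v / r) ^ DIM('a)) * emeasure lborel S \<le> emeasure lborel {x\<in>S. v \<le> d x}"
    if v: "0 < v" "v < r" for v
  proof -
    define m where "m = 1 - v / r"
    have m: "0 < m" "m < 1" using v by (auto simp: m_def)
    have "ball (m *\<^sub>R y + (1 - m) *\<^sub>R z) v \<subseteq> S" if "y \<in> S" for y
    proof
      fix u assume u: "u \<in> ball (m *\<^sub>R y + (1 - m) *\<^sub>R z) v"
      \<comment> \<open>Since \<open>(1 - m) * r = v\<close>, a displacement shorter than
        \<open>v\<close> at the scaled point comes from a displacement \<open>h\<close> of
        \<open>z\<close> shorter than \<open>r\<close>; convexity combines \<open>y\<close> with
        \<open>z + h\<close>.\<close>
      define h where "h = (r / v) *\<^sub>R (u - (m *\<^sub>R y + (1 - m) *\<^sub>R z))"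
      have "norm h = r / v * norm (u - (m *\<^sub>R y + (1 - m) *\<^sub>R z))"
        using r v by (simp add: h_def)
      also have "\<dots> < r / v * v"
        using u r v by (intro mult_strict_left_mono) (auto simp: dist_norm norm_minus_commute)
      finally have "norm h < r" using v by simp
      then have "z + h \<in> S" using rS by (auto simp: dist_norm subset_iff)
      then have "m *\<^sub>R y + (1 - m) *\<^sub>R (z + h) \<in> S"
        using \<open>y \<in> S\<close> m S(2) by (intro convexD) auto
      moreover have "(1 - m) *\<^sub>R h = u - (m *\<^sub>R y + (1 - m) *\<^sub>R z)"
        using r v by (simp add: h_def m_def)
      ultimately show "u \<in> S" by (simp add: scaleR_add_right)
    qed
    then have "(\<lambda>y. m *\<^sub>R y + (1 - m) *\<^sub>R z) ` S \<subseteq> {x\<in>S. v \<le> d x}"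
      using v S ne unfolding d_def by (auto intro!: le_infdist_frontier simp: subset_iff)
    then have "emeasure lborel ((\<lambda>y. m *\<^sub>R y + (1 - m) *\<^sub>R z) ` S) \<le> emeasure lborel {x\<in>S. v \<le> d x}"
      by (intro emeasure_mono) auto
    then show ?thesis using m by (simp add: emeasure_lborel_affine flip: m_def)
  qed
  have "ennreal (r / (real DIM('a) + 1)) * emeasure lborel S
      = (\<integral>\<^sup>+v. (ennreal ((1 - v / r) ^ DIM('a)) * indicator {0<..<r} v) * emeasure lborel S \<partial>lborel)"
    by (subst nn_integral_multc) (simp_all add: nn_integral_power_one_minus_div[OF r])
  \<comment> \<open>Here \<open>r \<le> R\<close>, and levels from \<open>r\<close> up to
    \<open>R\<close> contribute nothing on the left.\<close>
  also have "\<dots> \<le> (\<integral>\<^sup>+v\<in>{0<..<R}. emeasure lborel {x\<in>S. v \<le> d x} \<partial>lborel)"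
    using level R[OF \<open>z \<in> S\<close>]
    by (intro nn_integral_mono) (auto simp: indicator_def r_def)
  also have "\<dots> = (\<integral>\<^sup>+x\<in>S. ennreal (d x) \<partial>lborel)"
    using R by (intro layer_cake[symmetric]) (auto simp: d_def infdist_nonneg)
  finally show ?thesis by (simp add: r_def)
qed simp

section \<open>Inradius, integral and admissible sets of the definitions\<close>

text \<open>Since \<open>bdist S\<close> is continuous, a superlevel set
  \<open>{c < bdist S}\<close> that meets the open set \<open>S\<close> does so in a nonempty open,
  hence non-null, set. So the essential supremum dominates every value.\<close>

lemma
  fixes S :: "(real ^ 'n) set"
  assumes "open S" "x \<in> S" and R: "\<And>y. y \<in> S \<Longrightarrow> bdist S y \<le> R"
  shows bdist_le_inradius: "bdist S x \<le> inradius S"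
    and inradius_le: "inradius S \<le> R"
proof -
  define E where "E = esssup (lebesgue_on S) (\<lambda>y. ereal \<bar>bdist S y\<bar>)"
  have d0: "\<bar>bdist S y\<bar> = bdist S y" for y by (simp add: bdist_def infdist_nonneg)
  have [measurable]: "bdist S \<in> borel_measurable borel"
    unfolding bdist_def by measurable
  have meas: "(\<lambda>y. ereal \<bar>bdist S y\<bar>) \<in> borel_measurable (lebesgue_on S)"
    by (intro measurable_restrict_space1 measurable_completion) measurable
  have le: "E \<le> ereal R"
    unfolding E_def using R by (intro esssup_I meas AE_I2) (simp add: d0)
  have ge: "ereal (bdist S x) \<le> E"
  proof (rule ccontr)
    assume "\<not> ereal (bdist S x) \<le> E"
    then obtain c where c: "E < ereal c" "c < bdist S x"
      using ereal_dense2[of E "ereal (bdist S x)"] by (auto simp: not_le)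
    let ?U = "S \<inter> {y. c < bdist S y}"
    have U: "open ?U"
      using \<open>open S\<close> unfolding bdist_def by (intro open_Int open_Collect_less continuous_intros)
    have "AE y in lebesgue_on S. ereal \<bar>bdist S y\<bar> \<le> E"
      unfolding E_def by (rule esssup_AE)
    then have "AE y in lebesgue. y \<in> S \<longrightarrow> ereal (bdist S y) \<le> E"
      using \<open>open S\<close> by (simp add: AE_restrict_space_iff d0)
    then have "AE y in lebesgue. y \<notin> ?U"
    proof eventually_elim
      case (elim y)
      with c(1) show ?case by (auto dest: order_le_less_trans)
    qed
    then have "negligible ?U"
      using U by (simp add: negligible_iff_null_sets AE_iff_null_sets)
    then show False
      using open_not_negligible[OF U] c(2) \<open>x \<in> S\<close> by auto
  qed
  \<comment> \<open>Bounded on both sides by reals, \<open>E\<close> is finite, so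
    \<open>real_of_ereal\<close> does not fall back to its default value.\<close>
  from le ge obtain e where e: "E = ereal e" by (cases E) auto
  have "inradius S = e" by (simp add: inradius_def e flip: E_def)
  then show "bdist S x \<le> inradius S" "inradius S \<le> R" using le ge e by auto
qed

lemma bdist_bounded:
  fixes S :: "(real ^ 'n) set"
  assumes "bounded S" "S \<noteq> {}"
  obtains R where "\<And>x. x \<in> S \<Longrightarrow> bdist S x \<le> R"
proof -
  obtain p where p: "p \<in> frontier S" using frontier_nonempty_of_bounded[OF assms(2,1)] by auto
  obtain R where R: "\<forall>x\<in>S. dist p x \<le> R" using assms(1) bounded_any_center by blast
  have "bdist S x \<le> R" if "x \<in> S" for x
    using R that infdist_le[OF p, of x] by (force simp: bdist_def dist_commute)
  then show thesis by (rule that)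
qed

lemma inradius_pos:
  fixes S :: "(real ^ 'n) set"
  assumes "open S" "bounded S" "S \<noteq> {}"
  shows "0 < inradius S"
proof -
  obtain x where x: "x \<in> S" using assms by auto
  then obtain r where r: "0 < r" "ball x r \<subseteq> S" using assms(1) by (auto simp: open_contains_ball)
  obtain R where R: "\<And>y. y \<in> S \<Longrightarrow> bdist S y \<le> R" using bdist_bounded assms by blast
  have "r \<le> bdist S x"
    unfolding bdist_def using r(2) assms by (intro le_infdist_frontier frontier_nonempty_of_bounded)
  also have "\<dots> \<le> inradius S" by (rule bdist_le_inradius[OF assms(1) x R])
  finally show ?thesis using r(1) by simp
qed

text \<open>Connects the Bochner integral in \<open>F_infty_1\<close> with the nonnegative integral
  handled by the layer-cake formula. Boundedness makes the latter finite, so passing through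
  \<open>enn2real\<close> loses nothing.\<close>

lemma ennreal_LINT_bdist:
  fixes S :: "(real ^ 'n) set"
  assumes "open S" "bounded S"
  shows "ennreal (LINT x:S|lebesgue. bdist S x) = (\<integral>\<^sup>+x\<in>S. ennreal (infdist x (frontier S)) \<partial>lborel)"
proof -
  have [measurable]: "S \<in> sets borel" using assms by simp
  have d: "bdist S x = infdist x (frontier S)" for x by (simp add: bdist_def)
  have eq: "(\<integral>\<^sup>+x. ennreal (indicator S x * infdist x (frontier S)) \<partial>lborel)
      = (\<integral>\<^sup>+x\<in>S. ennreal (infdist x (frontier S)) \<partial>lborel)"
    by (intro nn_integral_cong) (auto simp: indicator_def)
  have "(LINT x:S|lebesgue. bdist S x) = (LINT x|lborel. indicator S x * infdist x (frontier S))"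
    unfolding set_lebesgue_integral_def d by (simp add: integral_completion)
  also have "\<dots> = enn2real (\<integral>\<^sup>+x\<in>S. ennreal (infdist x (frontier S)) \<partial>lborel)"
    unfolding eq[symmetric] by (intro integral_eq_nn_integral) (auto simp: infdist_nonneg)
  finally have I: "(LINT x:S|lebesgue. bdist S x)
    = enn2real (\<integral>\<^sup>+x\<in>S. ennreal (infdist x (frontier S)) \<partial>lborel)" .
  have "(\<integral>\<^sup>+x\<in>S. ennreal (infdist x (frontier S)) \<partial>lborel) < \<infinity>"
  proof (cases "S = {}")
    case False
    then obtain R where R: "\<And>x. x \<in> S \<Longrightarrow> bdist S x \<le> R" using bdist_bounded assms by blast
    have "(\<integral>\<^sup>+x\<in>S. ennreal (infdist x (frontier S)) \<partial>lborel) \<le> (\<integral>\<^sup>+x\<in>S. ennreal R \<partial>lborel)"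
      using R by (intro nn_integral_mono) (auto simp: indicator_def d ennreal_leI)
    also have "\<dots> = ennreal R * emeasure lborel S" by (simp add: nn_integral_cmult_indicator)
    also have "\<dots> < \<infinity>" using emeasure_bounded_finite[OF assms(2)] by (simp add: ennreal_mult_less_top)
    finally show ?thesis .
  qed simp
  then show ?thesis unfolding I by simp
qed

text \<open>Nonempty open sets are not negligible, and an open convex set of finite measure is
  bounded; this replaces the measure conditions by topological ones.\<close>

lemma convex_domains_iff:
  fixes S :: "(real ^ 'n) set"
  shows "S \<in> convex_domains \<longleftrightarrow> open S \<and> convex S \<and> bounded S \<and> S \<noteq> {}"
proof -
  have "emeasure lebesgue S = emeasure lborel S" if "open S"
    using that by (simp add: emeasure_completion)
  moreover have "0 < emeasure lborel S" if "open S" "S \<noteq> {}"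
  proof -
    have "\<not> S \<in> null_sets lebesgue"
      using open_not_negligible[OF that] by (simp add: negligible_iff_null_sets)
    then show ?thesis using that(1) by (simp add: null_sets_def emeasure_completion zero_less_iff_neq_zero)
  qed
  ultimately show ?thesis
    using bounded_convex_finite_measure[of S] emeasure_bounded_finite[of S]
    unfolding convex_domains_def mem_Collect_eq by (metis emeasure_empty less_irrefl)
qed

lemma convex_domains_measure:
  fixes S :: "(real ^ 'n) set"
  assumes "S \<in> convex_domains"
  shows "0 < measure lebesgue S" "emeasure lborel S = ennreal (measure lebesgue S)"
proof -
  have S: "open S" "0 < emeasure lebesgue S" "emeasure lebesgue S < \<infinity>"
    using assms by (auto simp: convex_domains_def)
  then show "0 < measure lebesgue S"
    by (simp add: measure_def enn2real_positive_iff)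
  have "emeasure lborel S = emeasure lebesgue S" using S(1) by (simp add: emeasure_completion)
  also have "\<dots> = ennreal (measure lebesgue S)" using S(3) by (intro emeasure_eq_ennreal_measure) auto
  finally show "emeasure lborel S = ennreal (measure lebesgue S)" .
qed

lemma LINT_bdist_nonneg: "0 \<le> (LINT x:S|lebesgue. bdist S x)"
  unfolding set_lebesgue_integral_def
  by (intro integral_nonneg_AE) (auto simp: bdist_def infdist_nonneg)

section \<open>The two-sided estimate\<close>

lemma F_infty_1_bounds:
  fixes S :: "(real ^ 'n) set"
  assumes "S \<in> convex_domains"
  shows "1 / (real CARD('n) + 1) \<le> F_infty_1 S" "F_infty_1 S \<le> 1 / 2"
proof -
  have S: "open S" "convex S" "bounded S" "S \<noteq> {}" using assms convex_domains_iff by auto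
  define M where "M = measure lebesgue S"
  define I where "I = (LINT x:S|lebesgue. bdist S x)"
  define \<rho> where "\<rho> = inradius S"
  have M: "0 < M" "emeasure lborel S = ennreal M"
    using convex_domains_measure[OF assms] by (auto simp: M_def)
  have I: "0 \<le> I" "ennreal I = (\<integral>\<^sup>+x\<in>S. ennreal (infdist x (frontier S)) \<partial>lborel)"
    using ennreal_LINT_bdist[OF S(1,3)] by (auto simp: I_def LINT_bdist_nonneg)
  have \<rho>: "0 < \<rho>" unfolding \<rho>_def using S by (intro inradius_pos)
  have d\<rho>: "infdist x (frontier S) \<le> \<rho>" if "x \<in> S" for x
  proof -
    obtain R where "\<And>y. y \<in> S \<Longrightarrow> bdist S y \<le> R" using bdist_bounded S by blast
    from bdist_le_inradius[OF S(1) that this] show ?thesis by (simp add: bdist_def \<rho>_def)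
  qed
  have F: "F_infty_1 S = I / (\<rho> * M)" by (simp add: F_infty_1_def I_def \<rho>_def M_def)
  \<comment> \<open>The lower integral bound, solved for the distance at each point;
    \<open>inradius_le\<close> then turns the uniform bound into one for
    \<open>\<rho>\<close>.\<close>
  have "bdist S x \<le> I * (real CARD('n) + 1) / M" if "x \<in> S" for x
  proof -
    have "ennreal (bdist S x / (real CARD('n) + 1) * M) \<le> ennreal I"
      using nn_integral_infdist_frontier_lower[OF S(1-3) that d\<rho>] M
      by (simp add: I(2) bdist_def infdist_nonneg flip: ennreal_mult'')
    then show ?thesis using I(1) M(1) by (simp add: field_simps)
  qed
  moreover obtain x where "x \<in> S" using S by auto
  ultimately have "\<rho> \<le> I * (real CARD('n) + 1) / M"
    unfolding \<rho>_def using inradius_le[OF S(1)] by blast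
  then show "1 / (real CARD('n) + 1) \<le> F_infty_1 S"
    using M \<rho> unfolding F by (simp add: field_simps)
  \<comment> \<open>The integral estimate is available only for \<open>R\<close> above
    \<open>\<rho>\<close>; density of the reals yields the case \<open>R = \<rho>\<close>
    afterwards.\<close>
  have "2 * I \<le> R * M" if "\<rho> < R" for R
  proof -
    have "ennreal (2 * I) \<le> ennreal (R * M)"
      using nn_integral_infdist_frontier_upper[OF S d\<rho> that] M \<rho> that I(1)
      by (simp add: ennreal_mult flip: I(2))
    then show ?thesis using M \<rho> that by simp
  qed
  then have "2 * I / M \<le> R" if "\<rho> < R" for R
    using that M(1) by (simp add: pos_divide_le_eq)
  then have "2 * I / M \<le> \<rho>" by (rule dense_ge)
  then show "F_infty_1 S \<le> 1 / 2"
    using M \<rho> unfolding F by (simp add: field_simps)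
qed

section \<open>Balls attain the lower bound\<close>

text \<open>Compare with the radial projection of \<open>x\<close> onto the sphere; at the centre
  any unit direction will do.\<close>

lemma infdist_frontier_ball_le:
  fixes a :: "'a::euclidean_space"
  assumes "0 < r" "x \<in> ball a r"
  shows "infdist x (frontier (ball a r)) \<le> r - dist a x"
proof -
  obtain e where e: "norm e = 1" "x - a = norm (x - a) *\<^sub>R e"
  proof (cases "x = a")
    case True
    obtain e :: 'a where "norm e = 1" using vector_choose_size[of 1] by auto
    with True show thesis by (intro that[of e]) auto
  next
    case False
    then show thesis by (intro that[of "(x - a) /\<^sub>R norm (x - a)"]) auto
  qed
  have "a + r *\<^sub>R e \<in> frontier (ball a r)"
    using e \<open>0 < r\<close> by (simp add: dist_norm)
  then have "infdist x (frontier (ball a r)) \<le> dist x (a + r *\<^sub>R e)" by (rule infdist_le)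
  also have "x - (a + r *\<^sub>R e) = (norm (x - a) - r) *\<^sub>R e"
    using e(2) by (simp add: algebra_simps)
  then have "dist x (a + r *\<^sub>R e) = r - dist a x"
    using assms e(1) by (simp add: dist_norm norm_minus_commute)
  finally show ?thesis .
qed

text \<open>The set where the distance is at least \<open>v\<close> lies in the concentric ball of
  radius \<open>r - v\<close>, which matches the homothetic copy of the lower bound and reverses its
  inequality.\<close>

lemma nn_integral_infdist_frontier_ball_le:
  fixes a :: "'a::euclidean_space"
  assumes r: "0 < r"
  shows "(\<integral>\<^sup>+x\<in>ball a r. ennreal (infdist x (frontier (ball a r))) \<partial>lborel)
    \<le> ennreal (r / (real DIM('a) + 1)) * emeasure lborel (ball a r)"
proof -
  let ?d = "\<lambda>x. infdist x (frontier (ball a r))"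
  have d: "?d x \<le> r - dist a x" if "x \<in> ball a r" for x
    using infdist_frontier_ball_le[OF r that] .
  have level: "emeasure lborel {x\<in>ball a r. v \<le> ?d x}
      \<le> ennreal ((1 - v / r) ^ DIM('a)) * emeasure lborel (ball a r)" if v: "0 < v" "v < r" for v
  proof -
    have "emeasure lborel {x\<in>ball a r. v \<le> ?d x} \<le> emeasure lborel (cball a (r - v))"
      using d by (intro emeasure_mono) force+
    also have "\<dots> = ennreal (unit_ball_vol (real DIM('a)) * (r * (1 - v / r)) ^ DIM('a))"
      using v r by (simp add: emeasure_cball right_diff_distrib)
    also have "\<dots> = ennreal ((1 - v / r) ^ DIM('a)) * emeasure lborel (ball a r)"
      using v r by (simp add: emeasure_ball power_mult_distrib mult_ac flip: ennreal_mult'')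
    finally show ?thesis .
  qed
  have "?d x \<le> r" if "x \<in> ball a r" for x
    using d[OF that] zero_le_dist[of a x] by linarith
  then have "(\<integral>\<^sup>+x\<in>ball a r. ennreal (?d x) \<partial>lborel)
      = (\<integral>\<^sup>+v\<in>{0<..<r}. emeasure lborel {x\<in>ball a r. v \<le> ?d x} \<partial>lborel)"
    by (intro layer_cake) (auto simp: infdist_nonneg)
  also have "\<dots> \<le> (\<integral>\<^sup>+v. (ennreal ((1 - v / r) ^ DIM('a)) * indicator {0<..<r} v) * emeasure lborel (ball a r) \<partial>lborel)"
    using level by (intro nn_integral_mono) (auto simp: indicator_def)
  also have "\<dots> = ennreal (r / (real DIM('a) + 1)) * emeasure lborel (ball a r)"
    by (subst nn_integral_multc) (simp_all add: nn_integral_power_one_minus_div[OF r])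
  finally show ?thesis .
qed

lemma ball_in_convex_domains: "0 < r \<Longrightarrow> ball a r \<in> convex_domains"
  by (simp add: convex_domains_iff)

lemma F_infty_1_ball:
  fixes a :: "real ^ 'n"
  assumes r: "0 < r"
  shows "F_infty_1 (ball a r) = 1 / (real CARD('n) + 1)"
proof (rule antisym)
  let ?B = "ball a r"
  define M where "M = measure lebesgue ?B"
  define I where "I = (LINT x:?B|lebesgue. bdist ?B x)"
  have M: "0 < M" "emeasure lborel ?B = ennreal M"
    using convex_domains_measure[OF ball_in_convex_domains[OF r]] by (auto simp: M_def)
  have "ennreal I \<le> ennreal (r / (real CARD('n) + 1) * M)"
    using nn_integral_infdist_frontier_ball_le[OF r, of a] M r ennreal_LINT_bdist[of ?B]
    by (simp add: I_def flip: ennreal_mult'')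
  then have I: "I \<le> r / (real CARD('n) + 1) * M" using M r by simp
  have "bdist ?B x \<le> r" if "x \<in> ?B" for x
    unfolding bdist_def using infdist_frontier_ball_le[OF r that] zero_le_dist[of a x] by linarith
  then have "bdist ?B a \<le> inradius ?B"
    using r by (intro bdist_le_inradius) auto
  moreover have "r \<le> bdist ?B a"
    unfolding bdist_def using r by (intro le_infdist_frontier frontier_nonempty_of_bounded) auto
  ultimately have \<rho>: "r \<le> inradius ?B" by simp
  \<comment> \<open>The inradius stands in the denominator, so the bound
    \<open>r \<le> inradius ?B\<close> obtained at the centre is the direction needed.\<close>
  have "I / (inradius ?B * M) \<le> I / (r * M)"
    using r M \<rho> by (intro divide_left_mono mult_right_mono) (auto simp: I_def LINT_bdist_nonneg)
  also have "\<dots> \<le> 1 / (real CARD('n) + 1)"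
    using I r M(1) by (simp add: field_simps)
  finally show "F_infty_1 ?B \<le> 1 / (real CARD('n) + 1)"
    by (simp add: F_infty_1_def I_def M_def)
qed (rule F_infty_1_bounds[OF ball_in_convex_domains[OF r]])

section \<open>Long boxes approach the upper bound\<close>

text \<open>The vector \<open>u\<close> has coordinate \<open>s\<close> along \<open>k\<close> and
  \<open>t\<close> along every other axis, so these are the half-widths of the box.\<close>

lemma emeasure_symmetric_box:
  fixes k :: "'a::euclidean_space"
  assumes "k \<in> Basis" "0 \<le> s" "0 \<le> t"
    and u: "u = t *\<^sub>R One + (s - t) *\<^sub>R k"
  shows "emeasure lborel (box (- u) u) = ennreal (2 * s * (2 * t) ^ (DIM('a) - 1))"
proof -
  have uk: "u \<bullet> i = (if i = k then s else t)" if "i \<in> Basis" for i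
    using that assms by (simp add: inner_add_left inner_Basis)
  have "emeasure lborel (box (- u) u) = ennreal (\<Prod>i\<in>Basis. (u - - u) \<bullet> i)"
    using uk assms(2,3) by (intro emeasure_lborel_box) (simp add: inner_minus_left)
  also have "(\<Prod>i\<in>Basis. (u - - u) \<bullet> i) = (\<Prod>i\<in>Basis. if i = k then 2 * s else 2 * t)"
    by (intro prod.cong) (auto simp: inner_add_left uk)
  also have "\<dots> = 2 * s * (\<Prod>i\<in>Basis - {k}. if i = k then 2 * s else 2 * t)"
    using \<open>k \<in> Basis\<close> by (subst prod.remove[of _ k]) auto
  also have "(\<Prod>i\<in>Basis - {k}. if i = k then 2 * s else 2 * t) = (\<Prod>i\<in>Basis - {k}. 2 * t)"
    by (intro prod.cong) auto
  also have "\<dots> = (2 * t) ^ (DIM('a) - 1)"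
    using \<open>k \<in> Basis\<close> by simp
  finally show ?thesis .
qed

text \<open>The witness is the box with one side of length \<open>2\<close> and the others of length \<open>2 N\<close>.\<close>

lemma F_infty_1_slab:
  assumes "1 < N"
  obtains S :: "(real ^ 'n) set" where "S \<in> convex_domains"
    "1 / 2 * (1 - 1 / N) ^ (CARD('n) - 1) \<le> F_infty_1 S"
proof -
  obtain k :: "real ^ 'n" where k: "k \<in> Basis" using nonempty_Basis by blast
  define u :: "real ^ 'n" where "u = N *\<^sub>R One + (1 - N) *\<^sub>R k"
  define S where "S = box (- u) u"
  define n where "n = CARD('n) - 1"
  have uk: "u \<bullet> i = (if i = k then 1 else N)" if "i \<in> Basis" for i
    using that k by (simp add: u_def inner_add_left inner_Basis)
  have "0 \<in> S" using \<open>1 < N\<close> uk by (auto simp: S_def mem_box)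
  then have S: "open S" "convex S" "bounded S" "S \<noteq> {}"
    by (auto simp: S_def convex_box)
  then have dom: "S \<in> convex_domains" by (simp add: convex_domains_iff)
  define M where "M = measure lebesgue S"
  define I where "I = (LINT x:S|lebesgue. bdist S x)"
  have "ennreal M = ennreal (2 * 1 * (2 * N) ^ n)"
    using convex_domains_measure[OF dom] emeasure_symmetric_box[OF k, of 1 N u] \<open>1 < N\<close>
    by (simp add: M_def S_def n_def u_def)
  then have M: "M = 2 * (2 * N) ^ n"
    using \<open>1 < N\<close> by (simp add: M_def)
  \<comment> \<open>The two faces orthogonal to \<open>k\<close> give the bounds
    \<open>1 - k \<bullet> x\<close> and \<open>1 + k \<bullet> x\<close>, whose average is
    1.\<close>
  have d1: "infdist x (frontier S) \<le> 1" if x: "x \<in> S" for x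
  proof -
    have "- 1 < y \<bullet> k" "y \<bullet> k < 1" if "y \<in> S" for y
      using that k uk[OF k] unfolding S_def mem_box by (auto simp: inner_minus_left)
    then have "k \<bullet> y \<le> 1" "(- k) \<bullet> y \<le> 1" if "y \<in> S" for y
      using that by (force simp: inner_commute[of k])+
    then have "infdist x (frontier S) \<le> 1 - k \<bullet> x" "infdist x (frontier S) \<le> 1 - (- k) \<bullet> x"
      using k by (intro infdist_frontier_le_halfspace x; simp)+
    then show ?thesis by (simp add: inner_minus_left)
  qed
  have [measurable]: "S \<in> sets borel" using S by simp
  \<comment> \<open>The redundant \<open>v / 1\<close> and exponent 1 match the power integral with
    \<open>r = 1\<close> and \<open>n = 1\<close>. The long sides are bounded below independently of
    \<open>v\<close>, using \<open>N - v \<ge> N - 1\<close>.\<close>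
  have level: "ennreal ((1 - v / 1) ^ 1) * ennreal (2 * (2 * (N - 1)) ^ n)
      \<le> emeasure lborel {x\<in>S. v \<le> infdist x (frontier S)}" if v: "0 < v" "v < 1" for v
  proof -
    \<comment> \<open>The box with every half-width reduced by \<open>v\<close>: each of its points
      has a ball of radius \<open>v\<close> inside \<open>S\<close>.\<close>
    define w :: "real ^ 'n" where "w = (N - v) *\<^sub>R One + (1 - v - (N - v)) *\<^sub>R k"
    have wi: "w \<bullet> i = u \<bullet> i - v" if "i \<in> Basis" for i
      using that k uk[OF that] by (simp add: w_def inner_add_left inner_Basis)
    have "ball x v \<subseteq> S" if x: "x \<in> box (- w) w" for x
    proof
      fix y assume y: "y \<in> ball x v"
      have "- (u \<bullet> i) < y \<bullet> i \<and> y \<bullet> i < u \<bullet> i" if i: "i \<in> Basis" for i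
      proof -
        have "\<bar>(y - x) \<bullet> i\<bar> < v"
          using Basis_le_norm[OF i, of "y - x"] y by (simp add: dist_norm norm_minus_commute)
        moreover have "- (w \<bullet> i) < x \<bullet> i" "x \<bullet> i < w \<bullet> i"
          using x i by (auto simp: mem_box)
        ultimately show ?thesis
          unfolding wi[OF i] inner_diff_left abs_less_iff by linarith
      qed
      then show "y \<in> S" by (simp add: S_def mem_box)
    qed
    then have "box (- w) w \<subseteq> {x\<in>S. v \<le> infdist x (frontier S)}"
      using le_infdist_frontier[OF _ S(1) frontier_nonempty_of_bounded[OF S(4,3)]] v
      by (force simp: subset_iff)
    then have "emeasure lborel (box (- w) w) \<le> emeasure lborel {x\<in>S. v \<le> infdist x (frontier S)}"
      by (intro emeasure_mono) auto
    moreover have "emeasure lborel (box (- w) w) = ennreal (2 * (1 - v) * (2 * (N - v)) ^ n)"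
      using emeasure_symmetric_box[OF k, of "1 - v" "N - v" w] v \<open>1 < N\<close> by (simp add: w_def n_def)
    moreover have "(1 - v) * (2 * (2 * (N - 1)) ^ n) \<le> 2 * (1 - v) * (2 * (N - v)) ^ n"
    proof -
      have "(2 * (N - 1)) ^ n \<le> (2 * (N - v)) ^ n"
        using v \<open>1 < N\<close> by (intro power_mono) auto
      then have "(2 * (1 - v)) * (2 * (N - 1)) ^ n \<le> (2 * (1 - v)) * (2 * (N - v)) ^ n"
        using v by (intro mult_left_mono) auto
      then show ?thesis by (simp only: mult_ac)
    qed
    ultimately show ?thesis
      using v by (simp flip: ennreal_mult') (meson ennreal_leI order_trans)
  qed
  have "ennreal ((2 * (N - 1)) ^ n) = ennreal (1 / (real 1 + 1) * (2 * (2 * (N - 1)) ^ n))" by simp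
  also have "\<dots> = ennreal (1 / (real 1 + 1)) * ennreal (2 * (2 * (N - 1)) ^ n)"
    using \<open>1 < N\<close> by (intro ennreal_mult) auto
  also have "\<dots>
      = (\<integral>\<^sup>+v. (ennreal ((1 - v / 1) ^ 1) * indicator {0<..<1} v) * ennreal (2 * (2 * (N - 1)) ^ n) \<partial>lborel)"
    by (subst nn_integral_multc) (simp_all only: nn_integral_power_one_minus_div[OF zero_less_one], measurable)
  also have "\<dots> \<le> (\<integral>\<^sup>+v\<in>{0<..<1}. emeasure lborel {x\<in>S. v \<le> infdist x (frontier S)} \<partial>lborel)"
    using level by (intro nn_integral_mono) (auto simp: indicator_def)
  also have "\<dots> = (\<integral>\<^sup>+x\<in>S. ennreal (infdist x (frontier S)) \<partial>lborel)"
    using d1 by (intro layer_cake[symmetric]) (auto simp: infdist_nonneg)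
  also have "\<dots> = ennreal I"
    unfolding I_def using S by (intro ennreal_LINT_bdist[symmetric])
  finally have I: "(2 * (N - 1)) ^ n \<le> I"
    by (simp add: I_def LINT_bdist_nonneg)
  have \<rho>: "0 < inradius S" "inradius S \<le> 1"
    using inradius_pos[OF S(1,3,4)] inradius_le[OF S(1) \<open>0 \<in> S\<close>, of 1] d1 by (auto simp: bdist_def)
  have "1 - 1 / N = 2 * (N - 1) / (2 * N)" using \<open>1 < N\<close> by (simp add: diff_divide_distrib)
  then have "(1 - 1 / N) ^ n = (2 * (N - 1)) ^ n / (2 * N) ^ n" by (simp only: power_divide)
  then have "1 / 2 * (1 - 1 / N) ^ n = (2 * (N - 1)) ^ n / M" by (simp add: M)
  also have "\<dots> \<le> I / M"
    using I M \<open>1 < N\<close> by (intro divide_right_mono) auto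
  also have "\<dots> \<le> I / (inradius S * M)"
    using \<rho> M \<open>1 < N\<close> LINT_bdist_nonneg[of S]
    by (intro divide_left_mono) (auto simp: I_def)
  also have "\<dots> = F_infty_1 S" by (simp add: F_infty_1_def I_def M_def)
  finally show thesis using dom that by (simp add: n_def)
qed

text \<open>The dimension is fixed, so the factor \<open>(1 - 1 / N) ^ (CARD('n) - 1)\<close> tends
  to 1 as the boxes grow. Taking \<open>N = Suc (Suc m)\<close> guarantees
  \<open>1 < N\<close>.\<close>

lemma F_infty_1_upper_bound_ge_half:
  assumes "\<And>S :: (real ^ 'n) set. S \<in> convex_domains \<Longrightarrow> F_infty_1 S \<le> c"
  shows "1 / 2 \<le> c"
proof (rule LIMSEQ_le_const2)
  have "(\<lambda>m. 1 / real (Suc (Suc m))) \<longlonglongrightarrow> 0"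
    by (intro LIMSEQ_Suc lim_1_over_n)
  then have "(\<lambda>m. 1 / 2 * (1 - 1 / real (Suc (Suc m))) ^ (CARD('n) - 1))
      \<longlonglongrightarrow> 1 / 2 * (1 - 0) ^ (CARD('n) - 1)"
    by (intro tendsto_intros)
  then show "(\<lambda>m. 1 / 2 * (1 - 1 / real (Suc (Suc m))) ^ (CARD('n) - 1)) \<longlonglongrightarrow> 1 / 2" by simp
  have "1 / 2 * (1 - 1 / real (Suc (Suc m))) ^ (CARD('n) - 1) \<le> c" for m
  proof -
    obtain S :: "(real ^ 'n) set" where "S \<in> convex_domains"
      "1 / 2 * (1 - 1 / real (Suc (Suc m))) ^ (CARD('n) - 1) \<le> F_infty_1 S"
      by (rule F_infty_1_slab[of "real (Suc (Suc m))"]) simp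
    with assms[of S] show ?thesis by linarith
  qed
  then show "\<exists>M. \<forall>m\<ge>M. 1 / 2 * (1 - 1 / real (Suc (Suc m))) ^ (CARD('n) - 1) \<le> c" by blast
qed

theorem proposition6p1:
  shows
    "(\<forall>\<Omega> :: (real ^ 'n) set.
        open \<Omega> \<and> convex \<Omega> \<and> 0 < emeasure lebesgue \<Omega> \<and> emeasure lebesgue \<Omega> < \<infinity> \<longrightarrow>
        1 / (real CARD('n) + 1)
          \<le> 1 / inradius \<Omega> * (1 / measure lebesgue \<Omega>) * (LINT x:\<Omega>|lebesgue. bdist \<Omega> x) \<and>
        1 / inradius \<Omega> * (1 / measure lebesgue \<Omega>) * (LINT x:\<Omega>|lebesgue. bdist \<Omega> x) \<le> 1 / 2)
     \<and> (\<forall>c. (\<forall>\<Omega> \<in> convex_domains :: (real ^ 'n) set set. c \<le> F_infty_1 \<Omega>)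
            \<longrightarrow> c \<le> 1 / (real CARD('n) + 1))
     \<and> (\<forall>c. (\<forall>\<Omega> \<in> convex_domains :: (real ^ 'n) set set. F_infty_1 \<Omega> \<le> c) \<longrightarrow> 1 / 2 \<le> c)
     \<and> (SUP \<Omega> \<in> convex_domains :: (real ^ 'n) set set. F_infty_1 \<Omega>) = 1 / 2
     \<and> (\<forall>(a :: real ^ 'n) r. 0 < r \<longrightarrow>
          is_arg_min F_infty_1 (\<lambda>\<Omega>. \<Omega> \<in> convex_domains) (ball a r)
          \<and> F_infty_1 (ball a r) = 1 / (real CARD('n) + 1))"
proof (intro conjI allI impI)
  fix \<Omega> :: "(real ^ 'n) set"
  assume "open \<Omega> \<and> convex \<Omega> \<and> 0 < emeasure lebesgue \<Omega> \<and> emeasure lebesgue \<Omega> < \<infinity>"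
  then have "\<Omega> \<in> convex_domains" unfolding convex_domains_def by blast
  from F_infty_1_bounds[OF this]
  show "1 / (real CARD('n) + 1)
      \<le> 1 / inradius \<Omega> * (1 / measure lebesgue \<Omega>) * (LINT x:\<Omega>|lebesgue. bdist \<Omega> x)"
    and "1 / inradius \<Omega> * (1 / measure lebesgue \<Omega>) * (LINT x:\<Omega>|lebesgue. bdist \<Omega> x) \<le> 1 / 2"
    unfolding F_infty_1_def by auto
next
  fix c
  assume "\<forall>\<Omega> \<in> convex_domains :: (real ^ 'n) set set. c \<le> F_infty_1 \<Omega>"
  \<comment> \<open>The unit ball attains the value, so no larger lower bound is possible.\<close>
  then have "c \<le> F_infty_1 (ball (0 :: real ^ 'n) 1)"
    by (rule bspec[OF _ ball_in_convex_domains]) simp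
  then show "c \<le> 1 / (real CARD('n) + 1)" by (simp add: F_infty_1_ball)
next
  fix c
  assume "\<forall>\<Omega> \<in> convex_domains :: (real ^ 'n) set set. F_infty_1 \<Omega> \<le> c"
  then show "1 / 2 \<le> c" using F_infty_1_upper_bound_ge_half by blast
next
  show "(SUP \<Omega> \<in> convex_domains :: (real ^ 'n) set set. F_infty_1 \<Omega>) = 1 / 2"
  proof (rule cSup_eq_non_empty)
    show "F_infty_1 ` (convex_domains :: (real ^ 'n) set set) \<noteq> {}"
      using ball_in_convex_domains[of 1 "0 :: real ^ 'n"] by auto
    show "x \<le> 1 / 2" if "x \<in> F_infty_1 ` (convex_domains :: (real ^ 'n) set set)" for x
      using that F_infty_1_bounds(2) by blast
    show "1 / 2 \<le> y" if "\<And>x. x \<in> F_infty_1 ` (convex_domains :: (real ^ 'n) set set) \<Longrightarrow> x \<le> y" for y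
      using that F_infty_1_upper_bound_ge_half by blast
  qed
next
  fix a :: "real ^ 'n" and r :: real
  assume r: "0 < r"
  then show "F_infty_1 (ball a r) = 1 / (real CARD('n) + 1)" by (rule F_infty_1_ball)
  then show "is_arg_min F_infty_1 (\<lambda>\<Omega>. \<Omega> \<in> convex_domains) (ball a r)"
    using ball_in_convex_domains[OF r] F_infty_1_bounds(1)
    by (auto simp: is_arg_min_linorder)
qed

end
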